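(* Let $n \ge 2$ be a fixed integer and let $\mathcal{A}, \mathcal{B} \subseteq \mathbb{F}_{q^n}$. Suppose that $|\mathcal{A}| \ge |\mathcal{B}|$ and $|\mathcal{A}||\mathcal{B}| \gg q^{n+2}$. Then there exists a subset $\mathcal{A}' \subseteq \mathcal{A}$ with $|\mathcal{A}'| \gtrsim |\mathcal{A}|$ such that for every $X \in \mathcal{A}'$, the equation $N(X+Y) = \lambda$ is solvable in $Y \in \mathcal{B}$ for at least $(1-o(1))q$ values of $\lambda \in \mathbb{F}_q^{*}$.
   Context: $q$ is a power of an odd prime, viewed as an asymptotic parameter: $q\to\infty$, the sets may depend on $q$, and $o(1)$ denotes a quantity tending to $0$ as $q \to \infty$ (uniformly in $X\in\mathcal{A}'$). $X \ll Y$ (equivalently $Y \gg X$) means $X = o(Y)$; $X \lesssim Y$ (equivalently $Y\gtrsim X$) means that there is a constant $C>0$ with $X \le CY$. $\mathbb{F}_{q^n}$ is the extension of degree $n$ of the finite field $\mathbb{F}_q$. $N = N_{\mathbb{F}_{q^n}/\mathbb{F}_q}$ is the norm map, $N(X) = \prod_{i=0}^{n-1} X^{q^i} = X^{(q^n-1)/(q-1)}$, extended by $N(0)=0$. *)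

theory Defs
  imports Complex_Main "HOL-Algebra.Embedded_Algebras" "HOL-Number_Theory.Prime_Powers"
    "HOL-Library.Landau_Symbols"
begin

definition finite_field_extension ::
    "nat \<Rightarrow> nat \<Rightarrow> 'a ring \<Rightarrow> 'a set \<Rightarrow> bool"
  where "finite_field_extension q n F K \<longleftrightarrow>
    field F \<and> finite (carrier F) \<and> subfield K F \<and> card K = q \<and> ring.dimension F n K (carrier F)"

(* For n \<ge> 1 the product already has value \<zero> at X = \<zero>, since every exponent q ^ i is
   positive, so the convention N(0) = 0 needs no separate clause. *)
definition field_norm :: "nat \<Rightarrow> nat \<Rightarrow> 'a ring \<Rightarrow> 'a \<Rightarrow> 'a"
  where "field_norm q n F X = (\<Otimes>\<^bsub>F\<^esub>i\<in>{..<n}. X [^]\<^bsub>F\<^esub> (q ^ i))"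

definition attained_norms :: "nat \<Rightarrow> nat \<Rightarrow> 'a ring \<Rightarrow> 'a set \<Rightarrow> 'a set \<Rightarrow> 'a \<Rightarrow> 'a set"
  where "attained_norms q n F K B X =
    {l \<in> K - {\<zero>\<^bsub>F\<^esub>}. \<exists>Y\<in>B. field_norm q n F (X \<oplus>\<^bsub>F\<^esub> Y) = l}"

(* The limit q \<rightarrow> \<infinity> is taken along a sequence of fields and sets indexed by j, so that
   implied quantities tending to 0 are sequences in j. All the finite fields are realised on
   subsets of one type 'a; any infinite type contains a copy of each of them. *)
definition asymptotic_setting ::
    "nat \<Rightarrow> (nat \<Rightarrow> nat) \<Rightarrow> (nat \<Rightarrow> 'a ring) \<Rightarrow> (nat \<Rightarrow> 'a set) \<Rightarrow> bool"
  where "asymptotic_setting n q F K \<longleftrightarrow>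
    filterlim q at_top sequentially \<and>
    (\<forall>j. primepow (q j) \<and> odd (q j) \<and> finite_field_extension (q j) n (F j) (K j))"

end

theory Submission
  imports Defs "HOL-Algebra.Multiplicative_Group"
begin

text \<open>
  The proof is an elementary second moment argument. For \<open>x\<close> in the large field and a nonzero
  \<open>l\<close> in the base field let \<open>reps B x l\<close> be the number of \<open>y \<in> B\<close> with \<open>N (x + y) = l\<close>. The claim
  is that this number is rarely zero.

  Its sum over all pairs \<open>(x, l)\<close> is exactly \<open>|B| (q^n - 1)\<close> (\<open>sum_reps\<close>). Its sum of squares
  counts coincidences \<open>N (x + y) = N (x + y') \<noteq> 0\<close>. For \<open>y \<noteq> y'\<close> such a coincidence means that
  \<open>x + y = u (x + y')\<close> for some \<open>u \<noteq> 1\<close> of norm one, and \<open>u\<close> determines \<open>x\<close>. As \<open>N\<close> is the power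
  map with exponent \<open>M = (q^n - 1) / (q - 1)\<close>, there are at most \<open>M - 1\<close> such \<open>u\<close>
  (\<open>card_norm_collisions\<close>, \<open>sum_reps_squared\<close>). This is so close to what independence would give
  that the variance of \<open>reps B\<close>, summed over all pairs, is at most \<open>|B| q^n\<close>. The mean
  being at least \<open>|B| / q\<close>, Chebyshev's inequality leaves at most \<open>q^(n + 2) / |B|\<close> pairs with
  \<open>reps B x l = 0\<close> (\<open>card_missed_pairs\<close>).

  Once \<open>|A| |B| \<ge> 2 q^(n + 2)\<close>, at most half of the elements of \<open>A\<close> occur in such a pair. For all the
  others every nonzero \<open>l\<close> in the base field is attained (\<open>card_attaining_all_norms\<close>), so that the
  theorem holds with \<open>C = 2\<close> and \<open>\<epsilon> = 1 / q\<close> for all large \<open>j\<close>.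
\<close>

section \<open>Sizes of finite field extensions and the power description of the norm\<close>
lemma (in ring) card_Span:
  assumes K: "subfield K R" and fin: "finite K" and ind: "independent K Us"
  shows "finite (Span K Us) \<and> card (Span K Us) = card K ^ length Us"
  using ind
proof (induction Us rule: list.induct)
  case Nil
  then show ?case by simp
next
  case (Cons u Us)
  note u = independent_backwards[OF Cons.prems]
  note IH = Cons.IH[OF u(2)]
  note carr = independent_in_carrier[OF u(2)]
  have KR: "K \<subseteq> carrier R" using subfieldE(3)[OF K] .
  have SR: "Span K Us \<subseteq> carrier R" using Span_subgroup_props(1)[OF K carr] .
  let ?f = "\<lambda>(k, v). k \<otimes> u \<oplus> v"
  have img: "Span K (u # Us) = ?f ` (K \<times> Span K Us)"
    by (auto simp: line_extension_mem_iff image_iff; blast)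
  have "inj_on ?f (K \<times> Span K Us)"
  proof (rule inj_onI, clarify)
    fix k v k' v'
    assume k: "k \<in> K" "k' \<in> K" and v: "v \<in> Span K Us" "v' \<in> Span K Us"
      and eq: "k \<otimes> u \<oplus> v = k' \<otimes> u \<oplus> v'"
    have c: "k \<in> carrier R" "k' \<in> carrier R" "v \<in> carrier R" "v' \<in> carrier R"
      using k v KR SR by auto
    have "(k \<ominus> k') \<otimes> u = (k \<otimes> u \<oplus> v) \<ominus> (k' \<otimes> u \<oplus> v)"
      using c u(3) by algebra
    also have "\<dots> = v' \<ominus> v" unfolding eq using c u(3) by algebra
    finally have eq': "(k \<ominus> k') \<otimes> u = v' \<ominus> v" .
    have mem: "v' \<ominus> v \<in> Span K Us"
      using v Span_subgroup_props(3,4)[OF K carr] by (simp add: a_minus_def)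
    \<comment> \<open>Otherwise \<open>(k - k') u\<close> lies in the span of \<open>Us\<close>, and dividing by the scalar puts
      \<open>u\<close> there as well.\<close>
    have kk: "k = k'"
    proof (rule ccontr)
      assume "k \<noteq> k'"
      have "k \<ominus> k' \<in> K"
        using k subringE(5,7)[OF subfieldE(1)[OF K]] by (simp add: a_minus_def)
      with \<open>k \<noteq> k'\<close> c have "k \<ominus> k' \<in> K - {\<zero>}" by simp
      with mem eq' have "u \<in> Span K Us"
        using Span_m_inv_simprule[OF K carr _ u(3)] by simp
      with u(1) show False ..
    qed
    have "v' \<ominus> v = \<zero>" using eq'[symmetric] kk c u(3) by (simp add: r_neg a_minus_def)
    with c kk show "k = k' \<and> v = v'" by simp
  qed
  then have "card (Span K (u # Us)) = card K * card (Span K Us)"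
    unfolding img by (simp add: card_image card_cartesian_product)
  moreover have "finite (Span K (u # Us))" unfolding img using IH fin by simp
  ultimately show ?case using IH by simp
qed

lemma (in ring) card_dimension:
  assumes "subfield K R" "finite K" "dimension n K E"
  shows "card E = card K ^ n"
  using exists_base[OF assms(1,3)] card_Span[OF assms(1,2)] by auto

text \<open>
  Every nonzero element of \<open>K\<close> is such a root by Lagrange's theorem, and there are at most
  \<open>|K| - 1\<close> roots. This makes it possible to recognise elements of \<open>K\<close> by a power equation.
\<close>
lemma (in field) subfield_nonzero_eq_roots_of_unity:
  assumes fin: "finite (carrier R)" and K: "subfield K R"
  shows "K - {\<zero>} = {x \<in> carrier R. x [^] (card K - 1) = \<one>}"
proof (rule card_subset_eq)
  interpret L: field "R\<lparr>carrier := K\<rparr>" using subfield_iff(2)[OF K] .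
  have finK: "finite K" using finite_subset[OF subfieldE(3)[OF K] fin] .
  have gt: "card K - 1 \<noteq> 0"
  proof -
    have "card {\<zero>, \<one>} \<le> card K"
      using L.zero_closed L.one_closed finK by (intro card_mono) auto
    then show ?thesis using one_not_zero by simp
  qed
  show "finite {x \<in> carrier R. x [^] (card K - 1) = \<one>}" using fin by simp
  show sub: "K - {\<zero>} \<subseteq> {x \<in> carrier R. x [^] (card K - 1) = \<one>}"
  proof
    fix x assume x: "x \<in> K - {\<zero>}"
    interpret G: group "mult_of (R\<lparr>carrier := K\<rparr>)" by (rule L.field_mult_group)
    have "x [^]\<^bsub>mult_of (R\<lparr>carrier := K\<rparr>)\<^esub> order (mult_of (R\<lparr>carrier := K\<rparr>)) = \<one>\<^bsub>mult_of (R\<lparr>carrier := K\<rparr>)\<^esub>"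
      using x by (intro G.pow_order_eq_1) simp
    then have "x [^] (card K - 1) = \<one>"
      using L.order_mult_of finK by (simp add: nat_pow_mult_of order_def flip: nat_pow_consistent)
    with x subfieldE(3)[OF K] show "x \<in> {x \<in> carrier R. x [^] (card K - 1) = \<one>}" by auto
  qed
  have "card {x \<in> carrier R. x [^] (card K - 1) = \<one>} \<le> card K - 1"
    using num_roots_le_deg[OF fin gt] .
  moreover have "card (K - {\<zero>}) = card K - 1" using L.zero_closed finK by simp
  moreover have "card (K - {\<zero>}) \<le> card {x \<in> carrier R. x [^] (card K - 1) = \<one>}"
    using sub fin by (intro card_mono) auto
  ultimately show "card (K - {\<zero>}) = card {x \<in> carrier R. x [^] (card K - 1) = \<one>}" by simp
qed

lemma (in cring) field_norm_eq_pow: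
  assumes "x \<in> carrier R"
  shows "(\<Otimes>i\<in>{..<n}. x [^] (q ^ i :: nat)) = x [^] (\<Sum>i<n. q ^ i)"
  using assms by (induction n) (auto simp: lessThan_Suc nat_pow_mult m_comm add.commute)

section \<open>A second moment bound\<close>

text \<open>
  Chebyshev's inequality: every zero of \<open>f\<close> contributes \<open>\<mu>\<^sup>2\<close> to the sum of \<open>(f s - \<mu>)\<^sup>2\<close>.
  This sum is expanded on the right-hand side, so that only the first two moments of \<open>f\<close> are
  needed.
\<close>
lemma card_zeros_le_variance:
  fixes f :: "'b \<Rightarrow> real"
  assumes "finite S"
  shows "real (card {s \<in> S. f s = 0}) * \<mu>\<^sup>2 \<le> (\<Sum>s\<in>S. (f s)\<^sup>2) - 2 * \<mu> * (\<Sum>s\<in>S. f s) + real (card S) * \<mu>\<^sup>2"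
proof -
  have "real (card {s \<in> S. f s = 0}) * \<mu>\<^sup>2 = (\<Sum>s\<in>{s \<in> S. f s = 0}. (f s - \<mu>)\<^sup>2)" by simp
  also have "\<dots> \<le> (\<Sum>s\<in>S. (f s - \<mu>)\<^sup>2)" using assms by (intro sum_mono2) auto
  also have "\<dots> = (\<Sum>s\<in>S. (f s)\<^sup>2) - 2 * \<mu> * (\<Sum>s\<in>S. f s) + real (card S) * \<mu>\<^sup>2"
    by (simp add: power2_diff sum.distrib sum_subtractf sum_distrib_left sum_distrib_right mult_ac)
  finally show ?thesis .
qed

section \<open>The norm as a map with few collisions\<close>
locale finite_extension = field F for F :: "'a ring" (structure) +
  fixes q n :: nat and K :: "'a set"
  assumes finite_carrier: "finite (carrier F)"
    and subfield_K: "subfield K F"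
    and card_K: "card K = q"
    and dim: "dimension n K (carrier F)"
    and n_pos: "n > 0"
begin

abbreviation N :: "'a \<Rightarrow> 'a" where "N \<equiv> field_norm q n F"

text \<open>
  \<open>M = (q^n - 1) / (q - 1)\<close>. It is both the exponent for which \<open>N x = x^M\<close> and a bound for the
  number of elements of norm one.
\<close>
definition M :: nat where "M = (\<Sum>i<n. q ^ i)"

lemma finite_K: "finite K"
  using finite_subset[OF subfieldE(3)[OF subfield_K] finite_carrier] .

lemma card_carrier: "card (carrier F) = q ^ n"
  using card_dimension[OF subfield_K finite_K dim] card_K by simp

lemma q_ge_2: "q \<ge> 2"
proof -
  have "card {\<zero>, \<one>} \<le> card K"
    using subringE(2,3)[OF subfieldE(1)[OF subfield_K]] finite_K by (intro card_mono) auto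
  then show ?thesis using one_not_zero card_K by simp
qed

lemma card_K_nonzero: "card (K - {\<zero>}) = q - 1"
  using subringE(2)[OF subfieldE(1)[OF subfield_K]] card_K by simp

lemma M_mult: "M * (q - 1) = q ^ n - 1"
proof -
  have "int M * (int q - 1) = int q ^ n - 1"
    unfolding M_def using power_diff_1_eq[of "int q" n] by (simp add: mult.commute)
  then have "int (M * (q - 1)) = int (q ^ n - 1)"
    using q_ge_2 by (simp add: of_nat_diff)
  then show ?thesis using of_nat_eq_iff by blast
qed

lemma M_ge: "q ^ n \<le> M * q"
proof -
  have "q ^ (n - 1) \<le> M"
    unfolding M_def using n_pos by (intro member_le_sum) auto
  then have "q ^ (n - 1) * q \<le> M * q" by simp
  then show ?thesis using n_pos by (cases n) (auto simp: mult.commute)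
qed

lemma M_pos: "M > 0"
  using M_ge q_ge_2 by (cases M) auto

lemma M_le: "M \<le> q ^ n"
proof -
  have "M * 1 \<le> M * (q - 1)" using q_ge_2 by (intro mult_le_mono2) auto
  then show ?thesis unfolding M_mult by simp
qed

lemma N_eq_pow: "x \<in> carrier F \<Longrightarrow> N x = x [^] M"
  unfolding field_norm_def M_def by (rule field_norm_eq_pow)

lemma N_zero: "N \<zero> = \<zero>"
  using M_pos by (simp add: N_eq_pow nat_pow_zero)

text \<open>
  Since \<open>M (q - 1)\<close> is the order of the multiplicative group, \<open>(N x)^(q - 1) = 1\<close>, which
  characterises the nonzero elements of the base field.
\<close>
lemma N_in_nonzero:
  assumes "x \<in> carrier F" "x \<noteq> \<zero>"
  shows "N x \<in> K - {\<zero>}"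
proof -
  interpret G: group "mult_of F" by (rule field_mult_group)
  have "x [^]\<^bsub>mult_of F\<^esub> order (mult_of F) = \<one>\<^bsub>mult_of F\<^esub>"
    using assms by (intro G.pow_order_eq_1) simp
  then have "x [^] (M * (q - 1)) = \<one>"
    unfolding M_mult using order_mult_of finite_carrier
    by (simp add: nat_pow_mult_of order_def card_carrier)
  then have "N x [^] (card K - 1) = \<one>"
    using assms by (simp add: N_eq_pow nat_pow_pow card_K)
  then show ?thesis
    unfolding subfield_nonzero_eq_roots_of_unity[OF finite_carrier subfield_K]
    using assms by (simp add: N_eq_pow)
qed

lemma N_mem_iff: "x \<in> carrier F \<Longrightarrow> N x \<in> K - {\<zero>} \<longleftrightarrow> x \<noteq> \<zero>"
  using N_in_nonzero N_zero by auto

lemma card_norm_one: "card {u \<in> carrier F. N u = \<one>} \<le> M"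
proof -
  have "{u \<in> carrier F. N u = \<one>} = {u \<in> carrier F. u [^] M = \<one>}"
    by (auto simp: N_eq_pow)
  then show ?thesis using num_roots_le_deg[OF finite_carrier, of M] M_pos by simp
qed

lemma card_nonzero_translate:
  assumes "y \<in> carrier F"
  shows "card {x \<in> carrier F. N (x \<oplus> y) \<in> K - {\<zero>}} = q ^ n - 1"
proof -
  have "{x \<in> carrier F. N (x \<oplus> y) \<in> K - {\<zero>}} = carrier F - {\<ominus> y}"
  proof -
    have "x \<oplus> y = \<zero> \<longleftrightarrow> x = \<ominus> y" if "x \<in> carrier F" for x
      using minus_equality[of x y] that assms by (auto simp: l_neg)
    moreover have "x \<oplus> y \<in> carrier F" if "x \<in> carrier F" for x
      using that assms by simp
    ultimately show ?thesis using N_mem_iff by auto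
  qed
  then show ?thesis using assms card_carrier by simp
qed

text \<open>
  If \<open>x + y\<close> and \<open>x + y'\<close> have the same nonzero norm, then \<open>x + y = u (x + y')\<close> with \<open>N u = 1\<close>.
  The quotient \<open>u\<close> differs from \<open>1\<close> because \<open>y \<noteq> y'\<close>, and then this equation is linear in \<open>x\<close>
  with leading coefficient \<open>1 - u \<noteq> 0\<close>, so \<open>u\<close> determines \<open>x\<close>. Hence there are at most as many
  collisions as elements \<open>u \<noteq> 1\<close> of norm one.
\<close>
lemma card_norm_collisions:
  assumes y: "y \<in> carrier F" "y' \<in> carrier F" "y \<noteq> y'"
  shows "card {x \<in> carrier F. N (x \<oplus> y) \<in> K - {\<zero>} \<and> N (x \<oplus> y) = N (x \<oplus> y')} \<le> M - 1"
proof -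
  let ?S = "{x \<in> carrier F. N (x \<oplus> y) \<in> K - {\<zero>} \<and> N (x \<oplus> y) = N (x \<oplus> y')}"
  let ?U = "{u \<in> carrier F. N u = \<one>}"
  let ?f = "\<lambda>x. (x \<oplus> y) \<otimes> inv (x \<oplus> y')"
  have nz: "x \<oplus> y \<noteq> \<zero>" "x \<oplus> y' \<noteq> \<zero>" "x \<in> carrier F" if "x \<in> ?S" for x
    using that N_mem_iff[of "x \<oplus> y"] N_mem_iff[of "x \<oplus> y'"] y by auto
  have f_mult: "?f x \<otimes> (x \<oplus> y') = x \<oplus> y" "?f x \<in> carrier F" if "x \<in> ?S" for x
    using nz[OF that] y by (auto simp: m_assoc field_Units)
  have f_ne: "?f x \<noteq> \<one>" if "x \<in> ?S" for x
  proof
    assume "?f x = \<one>"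
    then have "x \<oplus> y' = x \<oplus> y" using f_mult[OF that] nz[OF that] y by simp
    then have "\<ominus> x \<oplus> (x \<oplus> y') = \<ominus> x \<oplus> (x \<oplus> y)" by simp
    then show False using nz[OF that] y by (simp add: r_neg1)
  qed
  have "inj_on ?f ?S"
  proof (rule inj_onI)
    fix x x' assume x: "x \<in> ?S" "x' \<in> ?S" and eq: "?f x = ?f x'"
    define u where "u = ?f x"
    have u: "u \<in> carrier F" "u \<noteq> \<one>" "u \<otimes> (x \<oplus> y') = x \<oplus> y" "u \<otimes> (x' \<oplus> y') = x' \<oplus> y"
      using f_mult[OF x(1)] f_ne[OF x(1)] f_mult[OF x(2)] eq unfolding u_def by auto
    note c = nz(3)[OF x(1)] nz(3)[OF x(2)] y
    have "(u \<ominus> \<one>) \<otimes> (x \<ominus> x') = (u \<otimes> (x \<oplus> y') \<ominus> u \<otimes> (x' \<oplus> y')) \<ominus> (x \<ominus> x')"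
      using u(1) c by algebra
    also have "\<dots> = \<zero>" unfolding u(3,4) using c by algebra
    finally have "u \<ominus> \<one> = \<zero> \<or> x \<ominus> x' = \<zero>"
      using u(1) c by (simp add: integral_iff)
    with u c show "x = x'" by simp
  qed
  moreover have "?f ` ?S \<subseteq> ?U - {\<one>}"
  proof
    fix u assume "u \<in> ?f ` ?S"
    then obtain x where x: "x \<in> ?S" and u: "u = ?f x" by auto
    note c = nz[OF x] y
    have uc: "u \<in> carrier F" using f_mult(2)[OF x] u by simp
    have "N u \<otimes> N (x \<oplus> y') = N (u \<otimes> (x \<oplus> y'))"
      using uc c by (simp add: N_eq_pow nat_pow_distrib)
    also have "\<dots> = N (x \<oplus> y')" using f_mult(1)[OF x] u x by simp
    finally have "N u \<otimes> N (x \<oplus> y') = \<one> \<otimes> N (x \<oplus> y')"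
      using c by (simp add: N_eq_pow)
    moreover have "N (x \<oplus> y') \<noteq> \<zero>" using N_in_nonzero c by simp
    ultimately have "N u = \<one>"
      using uc c m_rcancel[of "N (x \<oplus> y')" "N u" \<one>] by (simp add: N_eq_pow)
    with uc u f_ne[OF x] show "u \<in> ?U - {\<one>}" by simp
  qed
  ultimately have "card ?S \<le> card (?U - {\<one>})"
    using finite_carrier by (intro card_inj_on_le) auto
  also have "\<dots> = card ?U - 1"
    by (simp add: N_eq_pow)
  also have "\<dots> \<le> M - 1" using card_norm_one by simp
  finally show ?thesis .
qed

section \<open>Moments of the number of representations\<close>
definition reps :: "'a set \<Rightarrow> 'a \<Rightarrow> 'a \<Rightarrow> real"
  where "reps B x l = real (card {y \<in> B. N (x \<oplus> y) = l})"

lemma reps_eq_sum: "finite B \<Longrightarrow> reps B x l = (\<Sum>y\<in>B. of_bool (N (x \<oplus> y) = l))"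
  by (simp add: reps_def sum.If_cases of_bool_def Int_def)

text \<open>
  For fixed \<open>y\<close>, each of the \<open>q^n - 1\<close> points \<open>x \<noteq> -y\<close> has exactly one norm \<open>N (x + y)\<close>, and it
  lies in the nonzero part of \<open>K\<close>.
\<close>
lemma sum_reps:
  assumes "B \<subseteq> carrier F"
  shows "(\<Sum>x\<in>carrier F. \<Sum>l\<in>K - {\<zero>}. reps B x l) = real (card B) * (real q ^ n - 1)"
proof -
  have B: "finite B" using finite_subset[OF assms finite_carrier] .
  have "(\<Sum>x\<in>carrier F. \<Sum>l\<in>K - {\<zero>}. reps B x l)
      = (\<Sum>x\<in>carrier F. \<Sum>y\<in>B. \<Sum>l\<in>K - {\<zero>}. of_bool (N (x \<oplus> y) = l))"
    by (simp only: reps_eq_sum[OF B] sum.swap[of _ B "K - {\<zero>}"])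
  also have "\<dots> = (\<Sum>x\<in>carrier F. \<Sum>y\<in>B. of_bool (N (x \<oplus> y) \<in> K - {\<zero>}))"
    using finite_K by (simp add: of_bool_def sum.delta)
  also have "\<dots> = (\<Sum>y\<in>B. \<Sum>x\<in>carrier F. of_bool (N (x \<oplus> y) \<in> K - {\<zero>}))"
    by (rule sum.swap)
  also have "\<dots> = (\<Sum>y\<in>B. real (card {x \<in> carrier F. N (x \<oplus> y) \<in> K - {\<zero>}}))"
    using finite_carrier by (simp add: sum.If_cases of_bool_def Int_def)
  also have "\<dots> = (\<Sum>y\<in>B. real (q ^ n - 1))"
    using assms by (intro sum.cong) (auto simp: card_nonzero_translate simp del: Diff_iff)
  also have "\<dots> = real (card B) * (real q ^ n - 1)"
    using q_ge_2 by (simp add: of_nat_diff)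
  finally show ?thesis .
qed

text \<open>
  The second moment counts triples \<open>(x, y, y')\<close> with \<open>N (x + y) = N (x + y')\<close> nonzero. The
  diagonal \<open>y = y'\<close> gives the first term, the collision bound gives the second.
\<close>
lemma sum_reps_squared:
  assumes "B \<subseteq> carrier F"
  shows "(\<Sum>x\<in>carrier F. \<Sum>l\<in>K - {\<zero>}. (reps B x l)\<^sup>2)
    \<le> real (card B) * (real q ^ n - 1) + real (card B) * (real (card B) - 1) * (real M - 1)"
proof -
  have B: "finite B" using finite_subset[OF assms finite_carrier] .
  let ?P = "\<lambda>x y y'. N (x \<oplus> y) \<in> K - {\<zero>} \<and> N (x \<oplus> y) = N (x \<oplus> y')"
  have inner: "(\<Sum>l\<in>K - {\<zero>}. of_bool (N (x \<oplus> y) = l) * of_bool (N (x \<oplus> y') = l))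
      = (of_bool (?P x y y') :: real)" for x y y'
  proof -
    have "(\<Sum>l\<in>K - {\<zero>}. of_bool (N (x \<oplus> y) = l) * of_bool (N (x \<oplus> y') = l))
      = (\<Sum>l\<in>K - {\<zero>}. if N (x \<oplus> y) = l then of_bool (N (x \<oplus> y) = N (x \<oplus> y')) else (0::real))"
      by (intro sum.cong) auto
    also have "\<dots> = of_bool (?P x y y')" using finite_K by (subst sum.delta') auto
    finally show ?thesis .
  qed
  have "(\<Sum>x\<in>carrier F. \<Sum>l\<in>K - {\<zero>}. (reps B x l)\<^sup>2)
      = (\<Sum>x\<in>carrier F. \<Sum>l\<in>K - {\<zero>}. \<Sum>y\<in>B. \<Sum>y'\<in>B.
            of_bool (N (x \<oplus> y) = l) * of_bool (N (x \<oplus> y') = l))"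
    by (simp add: reps_eq_sum[OF B] power2_eq_square sum_product)
  also have "\<dots> = (\<Sum>x\<in>carrier F. \<Sum>y\<in>B. \<Sum>y'\<in>B. \<Sum>l\<in>K - {\<zero>}.
            of_bool (N (x \<oplus> y) = l) * of_bool (N (x \<oplus> y') = l))"
    by (simp only: sum.swap[of _ B "K - {\<zero>}"])
  also have "\<dots> = (\<Sum>x\<in>carrier F. \<Sum>y\<in>B. \<Sum>y'\<in>B. of_bool (?P x y y'))"
    by (simp only: inner)
  also have "\<dots> = (\<Sum>y\<in>B. \<Sum>y'\<in>B. \<Sum>x\<in>carrier F. of_bool (?P x y y'))"
    by (simp only: sum.swap[of _ B "carrier F"])
  also have "\<dots> = (\<Sum>y\<in>B. \<Sum>y'\<in>B. real (card {x \<in> carrier F. ?P x y y'}))"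
    using finite_carrier by (simp add: sum.If_cases of_bool_def Int_def)
  also have "\<dots> \<le> (\<Sum>y\<in>B. \<Sum>y'\<in>B. (if y' = y then real q ^ n - 1 else real M - 1))"
  proof (intro sum_mono)
    fix y y' assume y: "y \<in> B" "y' \<in> B"
    show "real (card {x \<in> carrier F. ?P x y y'}) \<le> (if y' = y then real q ^ n - 1 else real M - 1)"
    proof (cases "y' = y")
      case True
      have "{x \<in> carrier F. ?P x y y'} = {x \<in> carrier F. N (x \<oplus> y) \<in> K - {\<zero>}}"
        using True by auto
      then show ?thesis
        using card_nonzero_translate[of y] y assms True q_ge_2 by (auto simp: of_nat_diff)
    next
      case False
      then have "card {x \<in> carrier F. ?P x y y'} \<le> M - 1"
        using card_norm_collisions[of y y'] y assms by blast
      then have "real (card {x \<in> carrier F. ?P x y y'}) \<le> real (M - 1)" by (rule of_nat_mono)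
      then show ?thesis using False M_pos by (simp add: of_nat_diff)
    qed
  qed
  also have "\<dots> = (\<Sum>y\<in>B. (real q ^ n - 1) + (real (card B) - 1) * (real M - 1))"
  proof (intro sum.cong refl)
    fix y assume y: "y \<in> B"
    have "(\<Sum>y'\<in>B. (if y' = y then real q ^ n - 1 else real M - 1))
      = (real q ^ n - 1) + (\<Sum>y'\<in>B - {y}. real M - 1)"
      using B y by (subst sum.remove[of B y]) auto
    moreover have "real (card (B - {y})) = real (card B) - 1"
      using B y card_gt_0_iff[of B] by (subst card_Diff_singleton) (auto simp: of_nat_diff Suc_le_eq)
    ultimately show "(\<Sum>y'\<in>B. (if y' = y then real q ^ n - 1 else real M - 1))
      = (real q ^ n - 1) + (real (card B) - 1) * (real M - 1)" by simp
  qed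
  also have "\<dots> = real (card B) * (real q ^ n - 1) + real (card B) * (real (card B) - 1) * (real M - 1)"
    by (simp add: algebra_simps)
  finally show ?thesis .
qed

text \<open>
  The mean of \<open>reps B x l\<close> over all pairs \<open>(x, l)\<close> is \<open>\<mu> = |B| M / q^n\<close>, which is at least
  \<open>|B| / q\<close>. With this \<open>\<mu>\<close> the terms \<open>|B|\<^sup>2 M\<close> in the variance cancel, what is left of order
  \<open>|B|\<^sup>2\<close> is not positive, and at most \<open>|B| q^n\<close> remains; the number of pairs where \<open>reps\<close> vanishes is therefore at most
  \<open>|B| q^n / \<mu>\<^sup>2 \<le> q^(n + 2) / |B|\<close>.
\<close>
lemma card_missed_pairs:
  assumes BF: "B \<subseteq> carrier F"
  shows "real (card {(x, l). x \<in> carrier F \<and> l \<in> K - {\<zero>} \<and> (\<forall>y\<in>B. N (x \<oplus> y) \<noteq> l)}) * real (card B)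
    \<le> real q ^ (n + 2)"
proof (cases "B = {}")
  case True
  then show ?thesis by simp
next
  case False
  have B: "finite B" using finite_subset[OF BF finite_carrier] .
  define b Q m where "b = real (card B)" and "Q = real q ^ n" and "m = real M"
  define f where "f = (\<lambda>(x, l). reps B x l)"
  define S where "S = carrier F \<times> (K - {\<zero>})"
  define \<mu> where "\<mu> = b * m / Q"
  define z where "z = real (card {s \<in> S. f s = 0})"
  have pos: "b > 0" "Q > 0" "m > 0" "real q > 0" "b \<ge> 1"
    using False B q_ge_2 M_pos by (auto simp: b_def Q_def m_def card_gt_0_iff Suc_le_eq)
  have mq: "m * (real q - 1) = Q - 1" "Q \<le> m * real q" "m \<le> Q"
  proof -
    have "real (M * (q - 1)) = real (q ^ n - 1)" by (simp only: M_mult)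
    then show "m * (real q - 1) = Q - 1" using q_ge_2 by (simp add: m_def Q_def of_nat_diff)
    have "real (q ^ n) \<le> real (M * q)" using M_ge by (rule of_nat_mono)
    then show "Q \<le> m * real q" by (simp add: m_def Q_def)
    have "real M \<le> real (q ^ n)" using M_le by (rule of_nat_mono)
    then show "m \<le> Q" by (simp add: m_def Q_def)
  qed
  have finS: "finite S" using finite_carrier finite_K by (simp add: S_def)
  have cardS: "real (card S) = Q * (real q - 1)"
    using q_ge_2 by (simp add: S_def card_cartesian_product card_carrier card_K_nonzero Q_def of_nat_diff)
  have s1: "(\<Sum>s\<in>S. f s) = b * (Q - 1)"
    using sum_reps[OF BF] by (simp add: S_def f_def sum.cartesian_product b_def Q_def)
  have s2: "(\<Sum>s\<in>S. (f s)\<^sup>2) \<le> b * (Q - 1) + b * (b - 1) * (m - 1)"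
    using sum_reps_squared[OF BF]
    by (simp add: S_def f_def sum.cartesian_product b_def Q_def m_def case_prod_beta)
  have "z * \<mu>\<^sup>2 \<le> b * (Q - 1) + b * (b - 1) * (m - 1) - 2 * \<mu> * (b * (Q - 1)) + Q * (real q - 1) * \<mu>\<^sup>2"
    using card_zeros_le_variance[OF finS, of f \<mu>] s1 s2 cardS by (simp add: z_def)
  also have "Q * (real q - 1) * \<mu>\<^sup>2 = \<mu> * (b * (Q - 1))"
    using pos by (simp add: \<mu>_def power2_eq_square mq(1)[symmetric])
  also have "2 * \<mu> * (b * (Q - 1)) = 2 * (\<mu> * (b * (Q - 1)))" by simp
  also have "\<mu> * (b * (Q - 1)) = b\<^sup>2 * m - b * \<mu>"
    using pos by (simp add: \<mu>_def power2_eq_square field_simps)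
  finally have "z * \<mu>\<^sup>2 \<le> b * (Q - 1) + b * (b - 1) * (m - 1) - b\<^sup>2 * m + b * \<mu>"
    by (simp add: mult_ac)
  also have "\<dots> = b * Q - b * m - b * (b - \<mu>)"
    by (simp add: algebra_simps power2_eq_square)
  also have "\<dots> \<le> b * Q"
  proof -
    have "\<mu> \<le> b" using pos mq by (simp add: \<mu>_def field_simps)
    then have "0 \<le> b * (b - \<mu>)" "0 \<le> b * m" using pos by auto
    then show ?thesis by simp
  qed
  finally have zb: "z * \<mu>\<^sup>2 \<le> b * Q" .
  have "z * b\<^sup>2 \<le> z * (\<mu> * real q)\<^sup>2"
  proof (intro mult_left_mono power_mono)
    have "b * Q \<le> b * (m * real q)" using mq pos by (intro mult_left_mono) auto
    then show "b \<le> \<mu> * real q" using pos by (simp add: \<mu>_def field_simps)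
  qed (use pos in \<open>auto simp: z_def\<close>)
  also have "\<dots> = (z * \<mu>\<^sup>2) * (real q)\<^sup>2" by (simp add: power_mult_distrib)
  also have "\<dots> \<le> (b * Q) * (real q)\<^sup>2" using zb by (intro mult_right_mono) auto
  finally have "b * (z * b) \<le> b * (Q * (real q)\<^sup>2)" by (simp add: power2_eq_square mult_ac)
  then have "z * b \<le> Q * (real q)\<^sup>2" using pos by simp
  moreover have "{s \<in> S. f s = 0}
      = {(x, l). x \<in> carrier F \<and> l \<in> K - {\<zero>} \<and> (\<forall>y\<in>B. N (x \<oplus> y) \<noteq> l)}"
    using B by (auto simp: S_def f_def reps_def)
  ultimately show ?thesis by (simp add: z_def b_def Q_def power_add power2_eq_square mult_ac)
qed

text \<open>
  Each \<open>x\<close> that misses some value \<open>l\<close> belongs to at least one missed pair, and by assumption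
  there are at most \<open>|A| / 2\<close> missed pairs.
\<close>
lemma card_attaining_all_norms:
  assumes BF: "B \<subseteq> carrier F" and AF: "A \<subseteq> carrier F"
    and large: "2 * real q ^ (n + 2) \<le> real (card A) * real (card B)"
  shows "real (card A) \<le> 2 * real (card {x \<in> A. attained_norms q n F K B x = K - {\<zero>}})"
proof -
  let ?G = "{x \<in> A. attained_norms q n F K B x = K - {\<zero>}}"
  let ?Z = "{(x, l). x \<in> carrier F \<and> l \<in> K - {\<zero>} \<and> (\<forall>y\<in>B. N (x \<oplus> y) \<noteq> l)}"
  have A: "finite A" using finite_subset[OF AF finite_carrier] .
  have b: "real (card B) > 0"
  proof -
    have "0 < 2 * real q ^ (n + 2)" using q_ge_2 by simp
    with large have "0 < real (card A) * real (card B)" by linarith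
    then show ?thesis by (simp add: zero_less_mult_iff)
  qed
  have Zsub: "?Z \<subseteq> carrier F \<times> K" by auto
  have finZ: "finite ?Z" by (rule finite_subset[OF Zsub]) (simp add: finite_carrier finite_K)
  have "A - ?G \<subseteq> fst ` ?Z"
  proof
    fix x assume x: "x \<in> A - ?G"
    then obtain l where "l \<in> K - {\<zero>}" "l \<notin> attained_norms q n F K B x"
      by (auto simp: attained_norms_def)
    then have "(x, l) \<in> ?Z" using x AF by (auto simp: attained_norms_def)
    then show "x \<in> fst ` ?Z" by force
  qed
  then have "card (A - ?G) \<le> card ?Z"
    using finZ card_mono[of "fst ` ?Z" "A - ?G"] card_image_le[OF finZ, of fst] by (meson finite_imageI le_trans)
  then have "real (card (A - ?G)) * real (card B) \<le> real (card ?Z) * real (card B)"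
    by (intro mult_right_mono) auto
  also have "\<dots> \<le> real q ^ (n + 2)" by (rule card_missed_pairs[OF BF])
  also have "\<dots> \<le> (real (card A) / 2) * real (card B)" using large by simp
  finally have "real (card (A - ?G)) \<le> real (card A) / 2" using b by simp
  moreover have "card (A - ?G) = card A - card ?G"
    using A by (intro card_Diff_subset) auto
  moreover have "card ?G \<le> card A" using A by (intro card_mono) auto
  ultimately show ?thesis by (simp add: of_nat_diff)
qed

end

section \<open>The asymptotic statement\<close>
theorem theorem2p9:
  fixes n :: nat
  assumes "n \<ge> 2"
  shows "\<exists>C>0::real. \<forall>(q :: nat \<Rightarrow> nat) (F :: nat \<Rightarrow> 'a ring) (K :: nat \<Rightarrow> 'a set)
          (A :: nat \<Rightarrow> 'a set) (B :: nat \<Rightarrow> 'a set).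
    asymptotic_setting n q F K \<longrightarrow>
    (\<forall>j. A j \<subseteq> carrier (F j) \<and> B j \<subseteq> carrier (F j) \<and> card (A j) \<ge> card (B j)) \<longrightarrow>
    (\<lambda>j. real (q j) ^ (n + 2)) \<in> o[sequentially](\<lambda>j. real (card (A j)) * real (card (B j))) \<longrightarrow>
    (\<exists>(A' :: nat \<Rightarrow> 'a set) (\<epsilon> :: nat \<Rightarrow> real).
      \<epsilon> \<longlonglongrightarrow> 0 \<and>
      (\<forall>j. A' j \<subseteq> A j \<and> real (card (A j)) \<le> C * real (card (A' j)) \<and>
        (\<forall>X\<in>A' j. real (card (attained_norms (q j) n (F j) (K j) (B j) X))
                   \<ge> (1 - \<epsilon> j) * real (q j))))"
proof (intro exI[of _ "2::real"] conjI allI impI)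
  fix q :: "nat \<Rightarrow> nat" and F :: "nat \<Rightarrow> 'a ring" and K A B :: "nat \<Rightarrow> 'a set"
  assume setting: "asymptotic_setting n q F K"
    and sub: "\<forall>j. A j \<subseteq> carrier (F j) \<and> B j \<subseteq> carrier (F j) \<and> card (A j) \<ge> card (B j)"
    and small: "(\<lambda>j. real (q j) ^ (n + 2)) \<in> o[sequentially](\<lambda>j. real (card (A j)) * real (card (B j)))"
  have ext: "finite_extension (F j) (q j) n (K j)" for j
    using setting assms
    by (auto simp: asymptotic_setting_def finite_field_extension_def finite_extension_def
        finite_extension_axioms_def)
  define large where "large j \<longleftrightarrow> 2 * real (q j) ^ (n + 2) \<le> real (card (A j)) * real (card (B j))" for j
  have ev: "eventually large sequentially"
    using landau_o.smallD[OF small, of "1 / 2"] by (simp add: large_def[abs_def] mult_ac)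
  define A' where "A' j = (if large j
    then {x \<in> A j. attained_norms (q j) n (F j) (K j) (B j) x = K j - {\<zero>\<^bsub>F j\<^esub>}} else A j)" for j
  \<comment> \<open>Attaining all \<open>q - 1\<close> nonzero values is attaining \<open>(1 - 1/q) q\<close> of them. For the finitely
    many \<open>j\<close> that are not large, the error \<open>1\<close> makes the requirement void.\<close>
  define \<epsilon> where "\<epsilon> j = (if large j then 1 / real (q j) else 1)" for j
  have "filterlim q at_top sequentially" using setting by (simp add: asymptotic_setting_def)
  then have "(\<lambda>j. 1 / real (q j)) \<longlonglongrightarrow> 0"
    by (intro tendsto_divide_0[OF tendsto_const] filterlim_at_top_imp_at_infinity
        filterlim_compose[OF filterlim_real_sequentially])
  then have "\<epsilon> \<longlonglongrightarrow> 0"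
    by (rule Lim_transform_eventually) (use ev in \<open>eventually_elim, simp add: \<epsilon>_def\<close>)
  moreover have "A' j \<subseteq> A j \<and> real (card (A j)) \<le> 2 * real (card (A' j)) \<and>
      (\<forall>X\<in>A' j. real (card (attained_norms (q j) n (F j) (K j) (B j) X)) \<ge> (1 - \<epsilon> j) * real (q j))" for j
  proof -
    interpret finite_extension "F j" "q j" n "K j" by (rule ext)
    show ?thesis
    proof (cases "large j")
      case True
      have "real (card (K j - {\<zero>\<^bsub>F j\<^esub>})) = (1 - 1 / real (q j)) * real (q j)"
        using q_ge_2 by (simp add: card_K_nonzero of_nat_diff field_simps)
      then show ?thesis
        using True card_attaining_all_norms[of "B j" "A j"] sub
        by (simp add: A'_def \<epsilon>_def large_def)
    next
      case False
      then show ?thesis by (simp add: A'_def \<epsilon>_def)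
    qed
  qed
  ultimately show "\<exists>(A' :: nat \<Rightarrow> 'a set) (\<epsilon> :: nat \<Rightarrow> real).
      \<epsilon> \<longlonglongrightarrow> 0 \<and>
      (\<forall>j. A' j \<subseteq> A j \<and> real (card (A j)) \<le> 2 * real (card (A' j)) \<and>
        (\<forall>X\<in>A' j. real (card (attained_norms (q j) n (F j) (K j) (B j) X))
                   \<ge> (1 - \<epsilon> j) * real (q j)))"
    by blast
qed simp

end
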